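(* Let $\mathrm{A}^{(n)}$ be an $N$-dimensional $n$-ary polyadic algebra with $m$-ary addition $\nu^{(m)}$, $m\ge 3$, and $r$-place multiaction $\rho^{(r)}$. The dimension $N$ is not arbitrary, but can only take the values $N=\ell_N(m-1)+1$ with $\ell_N\in\mathbb{N}_0$; that is, $$m=3:\ N=1,3,5,\dots,2\ell_N+1;\qquad m=4:\ N=1,4,7,\dots,3\ell_N+1;\qquad m=5:\ N=1,5,9,\dots,4\ell_N+1;\ \dots$$
   Context: An $n$-ary polyadic algebra over a polyadic field $K$ has an underlying set $A$ with an $m$-ary addition $\nu^{(m)}:A^m\to A$ (a commutative $m$-ary group operation), an $n$-ary multiplication and an $r$-place multiaction $\rho^{(r)}:K^r\times A\to A$ replacing scalar multiplication. The $\ell$-iterated addition $(\nu^{(m)})^{\circ\ell}$ is the composition of $\ell$ copies of $\nu^{(m)}$ (well defined by total associativity); it takes exactly $\ell(m-1)+1$ arguments ($\ell=0$ being the identity on one argument). No zero element is assumed to exist. $\mathrm{A}^{(n)}$ is $N$-dimensional if it has a (polyadic) basis $\{\mathrm{e}_i\mid i=1,\dots,N\}$, $N\in\mathbb{N}$, in which, by definition, every $a\in A$ is expanded as a polyadic sum with exactly one summand for each basis element: $$a=(\nu^{(m)})^{\circ\ell_N}\left[\rho^{(r)}\{\lambda_1^{(1)},\dots,\lambda_r^{(1)}\mid\mathrm{e}_1\},\dots,\rho^{(r)}\{\lambda_1^{(N)},\dots,\lambda_r^{(N)}\mid\mathrm{e}_N\}\right],\quad \lambda_i^{(j)}\in K,$$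 where $\ell_N\in\mathbb{N}_0$ is the number of additions used. *)

theory Defs
  imports Main "HOL-Library.Multiset"
begin

text \<open>
  An operation of arity \<open>n\<close> on a carrier \<open>A\<close> is a function on lists that is only relevant on
  \<open>tuples n A\<close>.
\<close>

definition tuples :: "nat \<Rightarrow> 'a set \<Rightarrow> 'a list set" where
  "tuples n A = {xs. length xs = n \<and> set xs \<subseteq> A}"

definition nary_op :: "nat \<Rightarrow> 'a set \<Rightarrow> ('a list \<Rightarrow> 'a) \<Rightarrow> bool" where
  "nary_op n A f \<longleftrightarrow> (\<forall>xs \<in> tuples n A. f xs \<in> A)"

definition totally_associative :: "nat \<Rightarrow> 'a set \<Rightarrow> ('a list \<Rightarrow> 'a) \<Rightarrow> bool" where
  "totally_associative n A f \<longleftrightarrow>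
     (\<forall>xs \<in> tuples (2 * n - 1) A. \<forall>i < n.
        f (take i xs @ [f (take n (drop i xs))] @ drop (i + n) xs) =
        f (f (take n xs) # drop n xs))"

definition nary_commutative :: "nat \<Rightarrow> 'a set \<Rightarrow> ('a list \<Rightarrow> 'a) \<Rightarrow> bool" where
  "nary_commutative n A f \<longleftrightarrow>
     (\<forall>xs \<in> tuples n A. \<forall>ys. mset ys = mset xs \<longrightarrow> f ys = f xs)"

definition uniquely_solvable :: "nat \<Rightarrow> 'a set \<Rightarrow> ('a list \<Rightarrow> 'a) \<Rightarrow> bool" where
  "uniquely_solvable n A f \<longleftrightarrow>
     (\<forall>xs \<in> tuples n A. \<forall>i < n. \<forall>b \<in> A. \<exists>!x. x \<in> A \<and> f (xs[i := x]) = b)"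

definition nary_group :: "nat \<Rightarrow> 'a set \<Rightarrow> ('a list \<Rightarrow> 'a) \<Rightarrow> bool" where
  "nary_group n A f \<longleftrightarrow>
     2 \<le> n \<and> A \<noteq> {} \<and> nary_op n A f \<and> totally_associative n A f \<and> uniquely_solvable n A f"

definition comm_nary_group :: "nat \<Rightarrow> 'a set \<Rightarrow> ('a list \<Rightarrow> 'a) \<Rightarrow> bool" where
  "comm_nary_group n A f \<longleftrightarrow> nary_group n A f \<and> nary_commutative n A f"

definition polyadic_distributive ::
    "nat \<Rightarrow> nat \<Rightarrow> 'a set \<Rightarrow> ('a list \<Rightarrow> 'a) \<Rightarrow> ('a list \<Rightarrow> 'a) \<Rightarrow> bool" where
  "polyadic_distributive m n A add mul \<longleftrightarrow>
     (\<forall>xs \<in> tuples n A. \<forall>i < n. \<forall>ys \<in> tuples m A.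
        mul (xs[i := add ys]) = add (map (\<lambda>y. mul (xs[i := y])) ys))"

definition polyadic_zero :: "nat \<Rightarrow> 'a set \<Rightarrow> ('a list \<Rightarrow> 'a) \<Rightarrow> 'a \<Rightarrow> bool" where
  "polyadic_zero n A mul z \<longleftrightarrow> z \<in> A \<and> (\<forall>xs \<in> tuples n A. z \<in> set xs \<longrightarrow> mul xs = z)"

text \<open>
  A polyadic field need not have a zero; if there is none, the multiplicative \<open>n\<close>-ary group is
  all of \<open>K\<close>.
\<close>

locale polyadic_field =
  fixes m n :: nat and K :: "'k set" and add mul :: "'k list \<Rightarrow> 'k"
  assumes add_group: "comm_nary_group m K add"
    and mul_op: "nary_op n K mul"
    and mul_assoc: "totally_associative n K mul"
    and mul_comm: "nary_commutative n K mul"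
    and distrib: "polyadic_distributive m n K add mul"
    and mul_group: "nary_group n {x \<in> K. \<not> polyadic_zero n K mul x} mul"

text \<open>
  No associativity, unit or zero is assumed for the multiplication \<open>\<mu>\<close>. The laws relating the
  multiaction \<open>\<rho>\<close> to the operations of \<open>K\<close> and to \<open>\<mu>\<close> vary with the arity shape and are not
  imposed, so that the locale covers all of these variants.
\<close>

locale polyadic_algebra = K: polyadic_field mK nK K addK mulK
  for mK nK :: nat and K :: "'k set" and addK mulK :: "'k list \<Rightarrow> 'k" +
  fixes m n r :: nat and A :: "'a set" and \<nu> \<mu> :: "'a list \<Rightarrow> 'a"
    and \<rho> :: "'k list \<Rightarrow> 'a \<Rightarrow> 'a"
  assumes vadd_group: "comm_nary_group m A \<nu>"
    and arity_mult: "2 \<le> n"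
    and mult_op: "nary_op n A \<mu>"
    and mult_distrib: "polyadic_distributive m n A \<nu> \<mu>"
    and arity_action: "1 \<le> r"
    and action_closed: "\<And>cs a. cs \<in> tuples r K \<Longrightarrow> a \<in> A \<Longrightarrow> \<rho> cs a \<in> A"
    and action_vadd:
      "\<And>cs xs. cs \<in> tuples r K \<Longrightarrow> xs \<in> tuples m A \<Longrightarrow> \<rho> cs (\<nu> xs) = \<nu> (map (\<rho> cs) xs)"

text \<open>
  \<open>iterated_op m f l xs a\<close>: some composition of \<open>l\<close> copies of the \<open>m\<close>-ary operation \<open>f\<close>, with
  argument list \<open>xs\<close>, has value \<open>a\<close>. By total associativity the value does not depend on
  how the copies of \<open>f\<close> are nested. The number of arguments is not prescribed.
\<close>

inductive iterated_op :: "nat \<Rightarrow> ('a list \<Rightarrow> 'a) \<Rightarrow> nat \<Rightarrow> 'a list \<Rightarrow> 'a \<Rightarrow> bool"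
  for m :: nat and f :: "'a list \<Rightarrow> 'a" where
  iter_0: "iterated_op m f 0 [x] x"
| iter_Suc: "iterated_op m f l (us @ [f ys] @ vs) a \<Longrightarrow> length ys = m \<Longrightarrow>
     iterated_op m f (Suc l) (us @ ys @ vs) a"

text \<open>
  The list \<open>es\<close> enumerates a polyadic basis, with \<open>l\<close> additions in every expansion; the \<open>j\<close>-th
  entry of \<open>\<Lambda>\<close> is the tuple of the \<open>r\<close> coefficients at the \<open>j\<close>-th basis element. Coefficients
  are not required to be unique.
\<close>

context polyadic_algebra
begin

definition polyadic_basis :: "nat \<Rightarrow> 'a list \<Rightarrow> bool" where
  "polyadic_basis l es \<longleftrightarrow>
     distinct es \<and> set es \<subseteq> A \<and>
     (\<forall>a \<in> A. \<exists>\<Lambda> \<in> tuples (length es) (tuples r K). iterated_op m \<nu> l (map2 \<rho> \<Lambda> es) a)"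

definition has_dimension :: "nat \<Rightarrow> nat \<Rightarrow> bool" where
  "has_dimension N l \<longleftrightarrow> (\<exists>es. polyadic_basis l es \<and> length es = N)"

end

end

theory Submission
  imports Defs
begin

text \<open>
  The theorem is a count of arguments. Replacing one argument of an expression by an \<open>m\<close>-ary sum
  of new ones raises their number by \<open>m - 1\<close>, so a composition of \<open>l\<close> copies of the addition
  takes exactly \<open>l * (m - 1) + 1\<close> of them. In a basis expansion each basis element contributes
  one summand, hence \<open>N\<close> is the number of arguments of the iterated addition. The carrier
  of an \<open>m\<close>-ary group is nonempty, so there is an element to expand.
\<close>

text \<open>
  The bound \<open>1 \<le> m\<close> guards against truncated subtraction: for \<open>m = 0\<close> each copy of the
  operation would shorten the argument list.
\<close>

lemma length_iterated_op:
  assumes "iterated_op m f l xs a" and "1 \<le> m"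
  shows "length xs = l * (m - 1) + 1"
  using assms by (induction rule: iterated_op.induct) auto

lemma (in polyadic_algebra) has_dimension_eq:
  assumes "has_dimension N l"
  shows "N = l * (m - 1) + 1"
proof -
  from assms obtain es where es: "polyadic_basis l es" "length es = N"
    unfolding has_dimension_def by blast
  from vadd_group have "2 \<le> m" and "A \<noteq> {}"
    unfolding comm_nary_group_def nary_group_def by auto
  from \<open>A \<noteq> {}\<close> obtain a where "a \<in> A"
    by blast
  with es(1) obtain \<Lambda> where
      "\<Lambda> \<in> tuples (length es) (tuples r K)" and "iterated_op m \<nu> l (map2 \<rho> \<Lambda> es) a"
    unfolding polyadic_basis_def by blast
  moreover from this(1) have "length (map2 \<rho> \<Lambda> es) = N"
    using es(2) by (simp add: tuples_def)
  ultimately show ?thesis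
    using length_iterated_op \<open>2 \<le> m\<close> by fastforce
qed

theorem mainTheorem4:
  fixes mK nK m n r N l\<^sub>N :: nat
    and K :: "'k set" and \<sigma> \<kappa> :: "'k list \<Rightarrow> 'k"
    and A :: "'a set" and \<nu> \<mu> :: "'a list \<Rightarrow> 'a" and \<rho> :: "'k list \<Rightarrow> 'a \<Rightarrow> 'a"
  assumes "polyadic_algebra mK nK K \<sigma> \<kappa> m n r A \<nu> \<mu> \<rho>"
    and "3 \<le> m"
    and "polyadic_algebra.has_dimension K m r A \<nu> \<rho> N l\<^sub>N"
  shows "N = l\<^sub>N * (m - 1) + 1 \<and>
         (m = 3 \<longrightarrow> N = 2 * l\<^sub>N + 1) \<and>
         (m = 4 \<longrightarrow> N = 3 * l\<^sub>N + 1) \<and>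
         (m = 5 \<longrightarrow> N = 4 * l\<^sub>N + 1)"
proof -
  have "N = l\<^sub>N * (m - 1) + 1"
    using polyadic_algebra.has_dimension_eq[OF assms(1,3)] .
  then show ?thesis by simp
qed

end
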